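(* Let $f_0\in\mathbb{R}^n$, let $\xi\sim\mathcal{N}(0,\sigma^2I_{n\times n})$ and define $y=f_0+\xi$. Let $f_1,\dots,f_M\in\mathbb{R}^n$ and let $f_\theta=\sum_{j=1}^M\theta_jf_j$ for all $\theta=(\theta_1,\dots,\theta_M)^T\in\mathbb{R}^M$. Let $$\hat\theta\in\operatorname*{argmin}_{\theta\in\Lambda^M}|f_\theta-y|_2^2 .$$ Then for all $x>0$, with probability greater than $1-\exp(-x)$, $$\frac1n|f_{\hat\theta}-f_0|_2^2\;\le\;\min_{\theta\in\Lambda^M}\frac1n|f_\theta-f_0|_2^2+2t_*^2+\frac{4\sigma^2x}{n},$$ where $$t_*^2=\min\left(\frac{4\sigma^2M}{n},\;\frac{31\,\sigma R\sqrt{\log\left(eM\sigma/(R\sqrt n)\right)}}{\sqrt n}\right)\quad\text{and}\quad R^2=\frac14\max_{j=1,\dots,M}\frac1n|f_j|_2^2 .$$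
   Context: Here $n\ge1$ and $M\ge2$ are integers, $\sigma>0$, and the vectors $f_0$ (unknown) and $f_1,\dots,f_M$ (the dictionary) are deterministic. $|\cdot|_2$ is the Euclidean norm on $\mathbb{R}^n$. $\Lambda^M=\{\theta\in\mathbb{R}^M:\ \sum_{j=1}^M\theta_j=1,\ \theta_j\ge 0\text{ for all }j=1,\dots,M\}$ is the simplex in $\mathbb{R}^M$.
   Formalization: In t_*^2 the logarithm is replaced by max(1, log(·)), and the second term is read as 0 when R=0: as printed the root is undefined for R√n > eMσ and the bound fails at R√n = eMσ; t_*^2 is unchanged when the log is at least (4/31)^2. *)

theory Defs
  imports "HOL-Probability.Probability"
begin

definition prob_simplex :: "(real ^ 'm) set" where
  "prob_simplex = {\<theta>. (\<Sum>j\<in>UNIV. \<theta> $ j) = 1 \<and> (\<forall>j. 0 \<le> \<theta> $ j)}"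

definition lin_comb :: "('m::finite \<Rightarrow> real ^ 'n) \<Rightarrow> real ^ 'm \<Rightarrow> real ^ 'n" where
  "lin_comb f \<theta> = (\<Sum>j\<in>UNIV. (\<theta> $ j) *\<^sub>R f j)"

(* xi has law N(0, sigma^2 I): its coordinates are independent N(0, sigma^2) variables.
   The second argument of normal_density is the standard deviation. *)
definition isotropic_gaussian :: "'w measure \<Rightarrow> real \<Rightarrow> ('w \<Rightarrow> real ^ 'n::finite) \<Rightarrow> bool" where
  "isotropic_gaussian P \<sigma> \<xi> \<longleftrightarrow>
     prob_space.indep_vars P (\<lambda>_. borel) (\<lambda>i \<omega>. \<xi> \<omega> $ i) UNIV \<and>
     (\<forall>i. distributed P lborel (\<lambda>\<omega>. \<xi> \<omega> $ i) (\<lambda>u. ennreal (normal_density 0 \<sigma> u)))"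

definition dict_radius :: "('m::finite \<Rightarrow> real ^ 'n::finite) \<Rightarrow> real" where
  "dict_radius f =
     sqrt (1 / 4 * Max (range (\<lambda>j. 1 / real CARD('n) * (norm (f j))\<^sup>2)))"

definition log_plus :: "real \<Rightarrow> real" where
  "log_plus a = max 1 (ln a)"

(* The square of the rate t_*, with dimension n, dictionary size M and radius R.
   With ln in place of log_plus the square root would be meaningless for R sqrt n > e M sigma
   (the HOL sqrt of a negative number is negative) and the rate would vanish at
   R sqrt n = e M sigma, where the oracle inequality fails.  Truncating at 1 leaves the rate
   unchanged wherever the logarithm is at least (4/31)^2, see tstar_sq_eq_ln.
   For R = 0 the second term, hence the rate, is 0, its limit as R tends to 0. *)
definition tstar_sq :: "real \<Rightarrow> nat \<Rightarrow> nat \<Rightarrow> real \<Rightarrow> real" where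
  "tstar_sq \<sigma> n M R =
     min (4 * \<sigma>\<^sup>2 * real M / real n)
         (31 * \<sigma> * R * sqrt (log_plus (exp 1 * real M * \<sigma> / (R * sqrt (real n)))) / sqrt (real n))"

lemma tstar_sq_eq_ln:
  assumes "0 < \<sigma>" "0 < n" "0 < M" "0 < R"
    and L: "(4 / 31)\<^sup>2 \<le> ln (exp 1 * real M * \<sigma> / (R * sqrt (real n)))"
  shows "tstar_sq \<sigma> n M R =
     min (4 * \<sigma>\<^sup>2 * real M / real n)
         (31 * \<sigma> * R * sqrt (ln (exp 1 * real M * \<sigma> / (R * sqrt (real n)))) / sqrt (real n))"
proof (cases "1 \<le> ln (exp 1 * real M * \<sigma> / (R * sqrt (real n)))")
  case True
  then show ?thesis by (simp add: tstar_sq_def log_plus_def max_def)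
next
  case False
  define s where "s = sqrt (real n)"
  define a where "a = exp 1 * real M * \<sigma> / (R * s)"
  have s: "0 < s" "real n = s * s" using assms by (auto simp: s_def)
  have a: "0 < a" "ln a < 1" "(4 / 31)\<^sup>2 \<le> ln a"
    using False L s(1) assms by (auto simp: a_def simp flip: s_def)
  then have "a < exp 1" by (metis exp_less_cancel_iff exp_ln)
  then have "exp 1 * (real M * \<sigma>) < exp 1 * (R * s)"
    using s assms by (simp add: a_def field_simps)
  then have u: "real M * \<sigma> \<le> R * s" by simp
  have low: "4 * \<sigma>\<^sup>2 * real M / real n \<le> 31 * \<sigma> * R * r / s" if "4 / 31 \<le> r" for r
  proof -
    have "4 * (real M * \<sigma>) \<le> (31 * r) * (R * s)"
      by (rule mult_mono) (use u that s(1) assms in auto)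
    then have "\<sigma> * (4 * (real M * \<sigma>)) / (s * s) \<le> \<sigma> * ((31 * r) * (R * s)) / (s * s)"
      using s assms by (intro divide_right_mono mult_left_mono) auto
    also have "\<dots> = 31 * \<sigma> * R * r / s" using s by (simp add: field_simps)
    finally show ?thesis by (simp add: s power2_eq_square mult_ac)
  qed
  have "4 / 31 \<le> sqrt (ln a)" using a(3) real_le_rsqrt by blast
  moreover have "4 / 31 \<le> sqrt (log_plus a)"
    by (rule real_le_rsqrt) (simp add: log_plus_def power2_eq_square)
  ultimately show ?thesis
    using low by (simp add: tstar_sq_def min_absorb1 flip: s_def a_def)
qed

end

theory Submission
  imports Defs
begin

text \<open>Let \<open>K\<close> be the convex hull of the dictionary, \<open>u\<close> the projection of the data on \<open>K\<close> (the
estimator), \<open>c\<close> the projection of \<open>f0\<close> on \<open>K\<close> (the oracle) and \<open>\<xi>\<close> the noise.  The variational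
inequality of projections (\<open>basic_inequality\<close>) reduces the oracle inequality to an upper bound on
  \<open>sup {2 (\<xi> \<bullet> (u - c)) - |u - c|^2 | u. u \<in> K}\<close>
of the form \<open>2 n tstar_sq + 4 \<sigma>^2 x\<close> outside an event of probability less than \<open>exp (- x)\<close>.
Dividing everything by \<open>\<sigma>\<close> makes the noise standard Gaussian, and the only property of the noise
that matters is its Laplace transform, \<open>E exp (\<zeta> \<bullet> w) = exp (|w|^2 / 2)\<close>.

The two terms of the rate come from two bounds on the supremum, each by a Chernoff argument.

\<^item> With \<open>M\<close> dictionary elements, \<open>u - c\<close> lies in a subspace of dimension at most \<open>M\<close>, and
  \<open>2 (\<zeta> \<bullet> h) - |h|^2\<close> is at most the squared norm of the projection of \<open>\<zeta>\<close> on it, a chi-square variable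
  with at most \<open>M\<close> degrees of freedom (\<open>subspace_noise_bound\<close>).

\<^item> The term with the logarithm counts sparse approximations.  Maurey's argument, applied to the
  quadratic functional itself rather than to its linear part, replaces \<open>u\<close> by an average of \<open>k\<close>
  dictionary elements at the price \<open>\<rho>^2 / k\<close>, where \<open>\<rho>\<close> bounds the norms of the dictionary after
  the division by \<open>\<sigma>\<close> (\<open>maurey\<close>).  There are at most \<open>(e (1 + M / k))^k\<close> such
  averages, and for a fixed vector \<open>h\<close> the variable \<open>2 (\<zeta> \<bullet> h) - |h|^2\<close> satisfies
  \<open>E exp (s (2 (\<zeta> \<bullet> h) - |h|^2)) = exp (s (2 s - 1) |h|^2)\<close>, which is \<open>1\<close> for \<open>s = 1 / 2\<close>.  So the
  negative quadratic term pays for the variance, and a union bound (\<open>finite_noise_bound\<close>) costs only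
  the logarithm of the number of averages.  Taking \<open>k\<close> close to \<open>\<rho> / sqrt L\<close>, where \<open>L\<close> is the truncated
  logarithm in the rate, balances the two costs (\<open>hull_noise_bound\<close>).\<close>

section \<open>Standard Gaussian vectors\<close>

text \<open>The law \<open>N(0, I)\<close> is encoded by its Laplace transform, which determines it.  This form is
coordinate free, and exponential moments are all that Chernoff bounds use of the law.\<close>

definition standard_gaussian :: "'w measure \<Rightarrow> ('w \<Rightarrow> 'a::euclidean_space) \<Rightarrow> bool" where
  "standard_gaussian P \<zeta> \<longleftrightarrow> \<zeta> \<in> borel_measurable P \<and>
     (\<forall>w. (\<integral>\<^sup>+\<omega>. ennreal (exp (\<zeta> \<omega> \<bullet> w)) \<partial>P) = ennreal (exp ((norm w)\<^sup>2 / 2)))"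

lemma nn_integral_normal_density:
  assumes "0 < \<sigma>"
  shows "(\<integral>\<^sup>+u. ennreal (normal_density \<mu> \<sigma> u) \<partial>lborel) = 1"
  using assms by (subst nn_integral_eq_integral) auto

text \<open>Completing the square: tilting \<open>N(0, \<sigma>^2)\<close> by \<open>exp (a u)\<close> gives a multiple of \<open>N(\<sigma>^2 a, \<sigma>^2)\<close>.\<close>

lemma nn_integral_normal_exp_linear:
  assumes "0 < \<sigma>"
  shows "(\<integral>\<^sup>+u. ennreal (normal_density 0 \<sigma> u) * ennreal (exp (a * u)) \<partial>lborel)
    = ennreal (exp (\<sigma>\<^sup>2 * a\<^sup>2 / 2))"
proof -
  have "normal_density 0 \<sigma> u * exp (a * u) = exp (\<sigma>\<^sup>2 * a\<^sup>2 / 2) * normal_density (\<sigma>\<^sup>2 * a) \<sigma> u" for u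
  proof -
    have "- u\<^sup>2 / (2 * \<sigma>\<^sup>2) + a * u = \<sigma>\<^sup>2 * a\<^sup>2 / 2 + - (u - \<sigma>\<^sup>2 * a)\<^sup>2 / (2 * \<sigma>\<^sup>2)"
      using assms by (simp add: field_simps power2_eq_square)
    then have "exp (- u\<^sup>2 / (2 * \<sigma>\<^sup>2)) * exp (a * u)
        = exp (\<sigma>\<^sup>2 * a\<^sup>2 / 2) * exp (- (u - \<sigma>\<^sup>2 * a)\<^sup>2 / (2 * \<sigma>\<^sup>2))"
      by (simp only: exp_add[symmetric])
    then show ?thesis by (simp add: normal_density_def)
  qed
  then have "(\<integral>\<^sup>+u. ennreal (normal_density 0 \<sigma> u) * ennreal (exp (a * u)) \<partial>lborel)
    = (\<integral>\<^sup>+u. ennreal (exp (\<sigma>\<^sup>2 * a\<^sup>2 / 2)) * ennreal (normal_density (\<sigma>\<^sup>2 * a) \<sigma> u) \<partial>lborel)"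
    by (simp add: ennreal_mult[symmetric])
  also have "\<dots> = ennreal (exp (\<sigma>\<^sup>2 * a\<^sup>2 / 2))"
    by (subst nn_integral_cmult) (auto simp: nn_integral_normal_density assms)
  finally show ?thesis .
qed

text \<open>The weight \<open>exp (u^2 / 4)\<close> turns the standard normal density into \<open>sqrt 2\<close> times that of \<open>N(0, 2)\<close>.\<close>

lemma nn_integral_std_normal_exp_square:
  "(\<integral>\<^sup>+u. ennreal (std_normal_density u) * ennreal (exp (u\<^sup>2 / 4)) \<partial>lborel) = ennreal (sqrt 2)"
proof -
  have "std_normal_density u * exp (u\<^sup>2 / 4) = sqrt 2 * normal_density 0 (sqrt 2) u" for u
  proof -
    have "exp (- u\<^sup>2 / 2) * exp (u\<^sup>2 / 4) = exp (- u\<^sup>2 / 4)"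
      by (simp add: exp_add[symmetric])
    then show ?thesis by (simp add: normal_density_def real_sqrt_mult field_simps)
  qed
  then have "(\<integral>\<^sup>+u. ennreal (std_normal_density u) * ennreal (exp (u\<^sup>2 / 4)) \<partial>lborel)
    = (\<integral>\<^sup>+u. ennreal (sqrt 2) * ennreal (normal_density 0 (sqrt 2) u) \<partial>lborel)"
    by (simp add: ennreal_mult[symmetric])
  also have "\<dots> = ennreal (sqrt 2)"
    by (subst nn_integral_cmult) (auto simp: nn_integral_normal_density)
  finally show ?thesis .
qed

lemma isotropic_gaussian_measurable:
  fixes \<xi> :: "'w \<Rightarrow> real ^ 'n::finite"
  assumes "isotropic_gaussian P \<sigma> \<xi>"
  shows "\<xi> \<in> borel_measurable P"
proof (rule borel_measurable_euclidean_space[THEN iffD2], rule ballI)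
  fix b :: "real ^ 'n" assume "b \<in> Basis"
  then obtain i where i: "b = axis i 1" by (auto simp: Basis_vec_def)
  have "distributed P lborel (\<lambda>\<omega>. \<xi> \<omega> $ i) (\<lambda>u. ennreal (normal_density 0 \<sigma> u))"
    using assms by (simp add: isotropic_gaussian_def)
  then have "(\<lambda>\<omega>. \<xi> \<omega> $ i) \<in> borel_measurable P"
    using distributed_measurable by force
  then show "(\<lambda>\<omega>. \<xi> \<omega> \<bullet> b) \<in> borel_measurable P"
    by (simp add: i inner_axis)
qed

lemma isotropic_gaussian_standardize:
  fixes \<xi> :: "'w \<Rightarrow> real ^ 'n::finite"
  assumes "prob_space P" "0 < \<sigma>" "isotropic_gaussian P \<sigma> \<xi>"
  shows "standard_gaussian P (\<lambda>\<omega>. \<xi> \<omega> /\<^sub>R \<sigma>)"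
proof -
  interpret prob_space P by fact
  have ind: "indep_vars (\<lambda>_. borel) (\<lambda>i \<omega>. \<xi> \<omega> $ i) UNIV"
    and dist: "\<And>i. distributed P lborel (\<lambda>\<omega>. \<xi> \<omega> $ i) (\<lambda>u. ennreal (normal_density 0 \<sigma> u))"
    using assms(3) by (auto simp: isotropic_gaussian_def)
  have [measurable]: "\<xi> \<in> borel_measurable P"
    by (rule isotropic_gaussian_measurable) fact
  have "(\<integral>\<^sup>+\<omega>. ennreal (exp ((\<xi> \<omega> /\<^sub>R \<sigma>) \<bullet> w)) \<partial>P) = ennreal (exp ((norm w)\<^sup>2 / 2))" for w
  proof -
    have "(\<integral>\<^sup>+\<omega>. ennreal (exp ((\<xi> \<omega> /\<^sub>R \<sigma>) \<bullet> w)) \<partial>P)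
        = (\<integral>\<^sup>+\<omega>. (\<Prod>i\<in>UNIV. ennreal (exp ((w $ i / \<sigma>) * \<xi> \<omega> $ i))) \<partial>P)"
      by (intro nn_integral_cong)
        (simp add: inner_vec_def prod_ennreal exp_sum[symmetric] sum_distrib_left field_simps)
    also have "\<dots> = (\<Prod>i\<in>UNIV. \<integral>\<^sup>+\<omega>. ennreal (exp ((w $ i / \<sigma>) * \<xi> \<omega> $ i)) \<partial>P)"
      by (intro indep_vars_nn_integral indep_vars_compose2[OF ind]) auto
    also have "\<dots> = (\<Prod>i\<in>UNIV. ennreal (exp ((w $ i)\<^sup>2 / 2)))"
    proof (intro prod.cong refl)
      fix i
      have "(\<integral>\<^sup>+\<omega>. ennreal (exp ((w $ i / \<sigma>) * \<xi> \<omega> $ i)) \<partial>P)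
        = (\<integral>\<^sup>+u. ennreal (normal_density 0 \<sigma> u) * ennreal (exp ((w $ i / \<sigma>) * u)) \<partial>lborel)"
        by (rule distributed_nn_integral[OF dist, symmetric]) simp
      then show "(\<integral>\<^sup>+\<omega>. ennreal (exp ((w $ i / \<sigma>) * \<xi> \<omega> $ i)) \<partial>P) = ennreal (exp ((w $ i)\<^sup>2 / 2))"
        using assms(2) by (simp only: nn_integral_normal_exp_linear) (simp add: power_divide)
    qed
    also have "\<dots> = ennreal (exp ((norm w)\<^sup>2 / 2))"
      by (simp add: prod_ennreal exp_sum[symmetric] sum_divide_distrib[symmetric]
          norm_vec_def L2_set_def sum_nonneg)
    finally show ?thesis .
  qed
  then show ?thesis by (simp add: standard_gaussian_def)
qed

section \<open>Noise along a subspace\<close>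

lemma exponential_markov:
  assumes P: "prob_space P" and Z: "Z \<in> borel_measurable P"
    and mgf: "(\<integral>\<^sup>+\<omega>. ennreal (exp (Z \<omega>)) \<partial>P) \<le> ennreal C" and "0 \<le> C"
  shows "measure P {\<omega> \<in> space P. c \<le> Z \<omega>} \<le> C * exp (- c)"
proof -
  interpret prob_space P by fact
  note Z[measurable]
  have "emeasure P {\<omega> \<in> space P. c \<le> Z \<omega>}
      \<le> emeasure P ({\<omega> \<in> space P. 1 \<le> ennreal (exp (- c)) * ennreal (exp (Z \<omega>))})"
  proof (intro emeasure_mono subsetI)
    fix \<omega> assume "\<omega> \<in> {\<omega> \<in> space P. c \<le> Z \<omega>}"
    then show "\<omega> \<in> {\<omega> \<in> space P. 1 \<le> ennreal (exp (- c)) * ennreal (exp (Z \<omega>))}"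
      by (auto simp: ennreal_mult[symmetric] exp_add[symmetric])
  qed measurable
  also have "\<dots> \<le> ennreal (exp (- c)) * (\<integral>\<^sup>+\<omega>. ennreal (exp (Z \<omega>)) * indicator (space P) \<omega> \<partial>P)"
    using nn_integral_Markov_inequality[of "\<lambda>\<omega>. ennreal (exp (Z \<omega>))" "space P" P "ennreal (exp (- c))"]
    by (simp add: conj_commute)
  also have "(\<integral>\<^sup>+\<omega>. ennreal (exp (Z \<omega>)) * indicator (space P) \<omega> \<partial>P) = (\<integral>\<^sup>+\<omega>. ennreal (exp (Z \<omega>)) \<partial>P)"
    by (intro nn_integral_cong) simp
  also have "ennreal (exp (- c)) * \<dots> \<le> ennreal (exp (- c)) * ennreal C"
    by (intro mult_left_mono mgf) simp
  also have "\<dots> = ennreal (C * exp (- c))"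
    using \<open>0 \<le> C\<close> by (simp add: ennreal_mult[symmetric] mult.commute)
  finally show ?thesis
    using \<open>0 \<le> C\<close> by (simp add: emeasure_eq_measure)
qed

text \<open>For \<open>w = 0\<close> this is the chi-square moment generating function at \<open>1 / 4\<close>.  Each square is linearised by an auxiliary standard normal
variable \<open>g\<close>: \<open>exp (v^2 / 4)\<close> is the mean of \<open>exp (g v / sqrt 2)\<close> over \<open>g\<close>.  After Fubini, the linear term
\<open>w\<close> has become \<open>w + (g / sqrt 2) b\<close>, still orthogonal to the remaining vectors; hence the induction
has to carry the term \<open>\<zeta> \<bullet> w\<close>.\<close>

lemma nn_integral_exp_sum_squares:
  assumes P: "prob_space P" and G: "standard_gaussian P \<zeta>"
    and "finite B" "pairwise orthogonal B" "\<And>b. b \<in> B \<Longrightarrow> norm b = 1"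
    and "\<And>b. b \<in> B \<Longrightarrow> orthogonal w b"
  shows "(\<integral>\<^sup>+\<omega>. ennreal (exp (\<zeta> \<omega> \<bullet> w + (\<Sum>b\<in>B. (\<zeta> \<omega> \<bullet> b)\<^sup>2) / 4)) \<partial>P)
    = ennreal (sqrt 2 ^ card B * exp ((norm w)\<^sup>2 / 2))"
  using assms(3-)
proof (induction B arbitrary: w rule: finite_induct)
  case empty
  then show ?case using G by (simp add: standard_gaussian_def)
next
  case (insert b B)
  interpret prob_space P by fact
  interpret pair_sigma_finite P lborel ..
  have [measurable]: "\<zeta> \<in> borel_measurable P" using G by (simp add: standard_gaussian_def)
  define E where "E w = (\<lambda>\<omega>. ennreal (exp (\<zeta> \<omega> \<bullet> w + (\<Sum>b\<in>B. (\<zeta> \<omega> \<bullet> b)\<^sup>2) / 4)))" for w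
  have orth: "orthogonal (w + (g / sqrt 2) *\<^sub>R b) b'" if "b' \<in> B" for b' g
    using insert that by (auto simp: orthogonal_def inner_add_left pairwise_insert)
  have nrm: "(norm (w + (g / sqrt 2) *\<^sub>R b))\<^sup>2 = (norm w)\<^sup>2 + g\<^sup>2 / 2" for g
    using insert.prems(3)[of b] insert.prems(2)[of b]
    by (simp add: norm_add_Pythagorean orthogonal_def power_divide)
  have "(\<integral>\<^sup>+\<omega>. ennreal (exp (\<zeta> \<omega> \<bullet> w + (\<Sum>b\<in>insert b B. (\<zeta> \<omega> \<bullet> b)\<^sup>2) / 4)) \<partial>P)
     = (\<integral>\<^sup>+\<omega>. E w \<omega> * (\<integral>\<^sup>+g. ennreal (std_normal_density g) * ennreal (exp ((\<zeta> \<omega> \<bullet> b / sqrt 2) * g)) \<partial>lborel) \<partial>P)"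
    using insert.hyps
    by (intro nn_integral_cong, subst nn_integral_normal_exp_linear)
      (auto simp: E_def ennreal_mult[symmetric] exp_add[symmetric] power_divide add_divide_distrib add_ac)
  also have "\<dots> = (\<integral>\<^sup>+\<omega>. (\<integral>\<^sup>+g. ennreal (std_normal_density g) * E (w + (g / sqrt 2) *\<^sub>R b) \<omega> \<partial>lborel) \<partial>P)"
    by (intro nn_integral_cong, subst nn_integral_cmult[symmetric])
      (auto intro!: nn_integral_cong
         simp: E_def ennreal_mult[symmetric] exp_add[symmetric] inner_add_right add_ac mult_ac)
  also have "\<dots> = (\<integral>\<^sup>+g. (\<integral>\<^sup>+\<omega>. ennreal (std_normal_density g) * E (w + (g / sqrt 2) *\<^sub>R b) \<omega> \<partial>P) \<partial>lborel)"
    unfolding E_def by (rule Fubini'[symmetric]) measurable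
  also have "\<dots> = (\<integral>\<^sup>+g. ennreal (std_normal_density g) * ennreal (sqrt 2 ^ card B * exp ((norm w)\<^sup>2 / 2 + g\<^sup>2 / 4)) \<partial>lborel)"
  proof (intro nn_integral_cong)
    fix g :: real
    have "(\<integral>\<^sup>+\<omega>. E (w + (g / sqrt 2) *\<^sub>R b) \<omega> \<partial>P)
        = ennreal (sqrt 2 ^ card B * exp ((norm w)\<^sup>2 / 2 + g\<^sup>2 / 4))"
      using insert.IH[of "w + (g / sqrt 2) *\<^sub>R b"] insert.prems orth
      by (simp add: E_def nrm pairwise_insert add_divide_distrib)
    moreover have "E v \<in> borel_measurable P" for v unfolding E_def by measurable
    ultimately show "(\<integral>\<^sup>+\<omega>. ennreal (std_normal_density g) * E (w + (g / sqrt 2) *\<^sub>R b) \<omega> \<partial>P)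
        = ennreal (std_normal_density g) * ennreal (sqrt 2 ^ card B * exp ((norm w)\<^sup>2 / 2 + g\<^sup>2 / 4))"
      by (simp add: nn_integral_cmult)
  qed
  also have "\<dots> = (\<integral>\<^sup>+g. ennreal (sqrt 2 ^ card B * exp ((norm w)\<^sup>2 / 2))
      * (ennreal (std_normal_density g) * ennreal (exp (g\<^sup>2 / 4))) \<partial>lborel)"
    by (intro nn_integral_cong) (simp add: exp_add ennreal_mult[symmetric] mult_ac)
  also have "\<dots> = ennreal (sqrt 2 ^ card B * exp ((norm w)\<^sup>2 / 2)) * ennreal (sqrt 2)"
    by (subst nn_integral_cmult) (simp_all only: nn_integral_std_normal_exp_square, simp)
  also have "\<dots> = ennreal (sqrt 2 ^ card (insert b B) * exp ((norm w)\<^sup>2 / 2))"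
    using insert.hyps by (simp add: ennreal_mult[symmetric] mult_ac)
  finally show ?case .
qed

text \<open>In an orthonormal basis of \<open>S\<close>, the inequality \<open>2 a b - a^2 \<le> b^2\<close> for each coordinate bounds the left
side by the chi-square sum \<open>W\<close>.  Since \<open>E exp (W / 4)\<close> is at most \<open>sqrt 2 ^ m\<close>, Markov's inequality leaves
\<open>sqrt 2 ^ m * exp (- 2 m - x)\<close>, which is less than \<open>exp (- x)\<close> because \<open>sqrt 2 < exp 2\<close>.\<close>

lemma subspace_noise_bound:
  assumes P: "prob_space P" and G: "standard_gaussian P \<zeta>"
    and S: "subspace S" and d: "dim S \<le> m" and m: "0 < m"
  obtains A where "A \<in> sets P" "1 - exp (- x) < measure P A"
    "\<And>\<omega> h. \<omega> \<in> A \<Longrightarrow> h \<in> S \<Longrightarrow> 2 * (\<zeta> \<omega> \<bullet> h) - (norm h)\<^sup>2 \<le> 8 * real m + 4 * x"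
proof -
  interpret prob_space P by fact
  obtain B where B: "pairwise orthogonal B" "\<And>b. b \<in> B \<Longrightarrow> norm b = 1" "independent B"
      "card B = dim S" "span B = S"
    using orthonormal_basis_subspace[OF S] by metis
  have fin: "finite B" using B(3) by (rule independent_imp_finite)
  define W where "W \<omega> = (\<Sum>b\<in>B. (\<zeta> \<omega> \<bullet> b)\<^sup>2)" for \<omega>
  have [measurable]: "\<zeta> \<in> borel_measurable P" using G by (simp add: standard_gaussian_def)
  have W[measurable]: "W \<in> borel_measurable P" unfolding W_def[abs_def] by measurable
  have "2 * (z \<bullet> h) - (norm h)\<^sup>2 \<le> (\<Sum>b\<in>B. (z \<bullet> b)\<^sup>2)" if "h \<in> S" for z h
  proof -
    have h: "h = (\<Sum>b\<in>B. (h \<bullet> b) *\<^sub>R b)"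
      using orthonormal_basis_expand[OF B(1,2) _ fin, of h] that B(5) by simp
    have "(norm h)\<^sup>2 = (\<Sum>b\<in>B. (h \<bullet> b)\<^sup>2)"
    proof -
      have "h \<bullet> h = h \<bullet> (\<Sum>b\<in>B. (h \<bullet> b) *\<^sub>R b)" using h by simp
      then show ?thesis
        by (simp add: inner_sum_right power2_eq_square flip: power2_norm_eq_inner)
    qed
    moreover have "z \<bullet> h = (\<Sum>b\<in>B. (h \<bullet> b) * (z \<bullet> b))"
      by (subst h) (simp add: inner_sum_right)
    ultimately have "2 * (z \<bullet> h) - (norm h)\<^sup>2 = (\<Sum>b\<in>B. 2 * ((h \<bullet> b) * (z \<bullet> b)) - (h \<bullet> b)\<^sup>2)"
      by (simp add: sum_subtractf sum_distrib_left)
    also have "\<dots> \<le> (\<Sum>b\<in>B. (z \<bullet> b)\<^sup>2)"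
    proof (intro sum_mono)
      fix b
      have "0 \<le> (z \<bullet> b - h \<bullet> b)\<^sup>2" by simp
      then show "2 * ((h \<bullet> b) * (z \<bullet> b)) - (h \<bullet> b)\<^sup>2 \<le> (z \<bullet> b)\<^sup>2"
        by (simp add: power2_diff mult_ac)
    qed
    finally show ?thesis .
  qed
  note le_W = this
  have "prob {\<omega> \<in> space P. 2 * real m + x \<le> W \<omega> / 4} \<le> sqrt 2 ^ card B * exp (- (2 * real m + x))"
  proof (rule exponential_markov[OF P])
    show "(\<integral>\<^sup>+\<omega>. ennreal (exp (W \<omega> / 4)) \<partial>P) \<le> ennreal (sqrt 2 ^ card B)"
      using nn_integral_exp_sum_squares[OF P G fin B(1) B(2), of 0]
      by (simp add: W_def orthogonal_def)
  qed auto
  also have "\<dots> < exp (- x)"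
  proof -
    have "sqrt 2 ^ card B \<le> sqrt 2 ^ m"
      using d B(4) by (intro power_increasing) auto
    also have "\<dots> < exp 2 ^ m"
    proof (rule power_strict_mono[OF _ _ m])
      have "sqrt 2 < 2" using sqrt2_less_2 .
      also have "2 < exp (2::real)" using exp_ge_add_one_self[of 2] by simp
      finally show "sqrt 2 < exp 2" .
    qed simp
    also have "\<dots> = exp (2 * real m)" by (simp add: exp_of_nat2_mult mult.commute exp_of_nat_mult)
    finally have "sqrt 2 ^ card B * exp (- (2 * real m + x)) < exp (2 * real m) * exp (- (2 * real m + x))"
      by simp
    then show ?thesis by (simp add: exp_add[symmetric])
  qed
  finally have lt: "prob {\<omega> \<in> space P. 2 * real m + x \<le> W \<omega> / 4} < exp (- x)" .
  have ev: "{\<omega> \<in> space P. 2 * real m + x \<le> W \<omega> / 4} \<in> sets P" by measurable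
  show thesis
  proof (rule that)
    show "space P - {\<omega> \<in> space P. 2 * real m + x \<le> W \<omega> / 4} \<in> sets P" using ev by auto
    show "1 - exp (- x) < prob (space P - {\<omega> \<in> space P. 2 * real m + x \<le> W \<omega> / 4})"
      using lt by (subst prob_compl[OF ev]) simp
    show "2 * (\<zeta> \<omega> \<bullet> h) - (norm h)\<^sup>2 \<le> 8 * real m + 4 * x"
      if "\<omega> \<in> space P - {\<omega> \<in> space P. 2 * real m + x \<le> W \<omega> / 4}" "h \<in> S" for \<omega> h
      using that le_W[of h "\<zeta> \<omega>"] by (auto simp: W_def not_le)
  qed
qed

section \<open>Noise over a finite set and Maurey averages\<close>

text \<open>A union bound.  At \<open>s = 1 / 2\<close> the last term vanishes, which is the natural choice when the norms of
the vectors are large.  If they are small, a larger \<open>s\<close> divides the logarithm of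
the cardinality by \<open>s\<close> at the cost of a term quadratic in \<open>r\<close>.\<close>

lemma finite_noise_bound:
  fixes \<zeta> :: "'w \<Rightarrow> 'a::euclidean_space"
  assumes P: "prob_space P" and G: "standard_gaussian P \<zeta>"
    and T: "finite T" "T \<noteq> {}" "\<And>h. h \<in> T \<Longrightarrow> norm h \<le> r"
    and s: "1 / 2 \<le> s"
  obtains A where "A \<in> sets P" "1 - exp (- y) \<le> measure P A"
    "\<And>\<omega> h. \<omega> \<in> A \<Longrightarrow> h \<in> T \<Longrightarrow>
      2 * (\<zeta> \<omega> \<bullet> h) - (norm h)\<^sup>2 \<le> (ln (real (card T)) + y) / s + (2 * s - 1) * r\<^sup>2"
proof -
  interpret prob_space P by fact
  have [measurable]: "\<zeta> \<in> borel_measurable P" using G by (simp add: standard_gaussian_def)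
  define c where "c = ln (real (card T)) + y + s * (2 * s - 1) * r\<^sup>2"
  have N: "0 < card T" using T by (simp add: card_gt_0_iff)
  \<comment> \<open>The inequality fails at \<open>h\<close> only on \<open>D h\<close>, both sides having been multiplied by \<open>s\<close>.\<close>
  define D where "D h = {\<omega> \<in> space P. c \<le> \<zeta> \<omega> \<bullet> ((2 * s) *\<^sub>R h) - s * (norm h)\<^sup>2}" for h
  have D[measurable]: "D h \<in> sets P" for h unfolding D_def by measurable
  have "prob (D h) \<le> exp (- y) / real (card T)" if h: "h \<in> T" for h
  proof -
    have "prob (D h) \<le> exp (s * (2 * s - 1) * (norm h)\<^sup>2) * exp (- c)"
      unfolding D_def
    proof (rule exponential_markov[OF P])
      have "(\<integral>\<^sup>+\<omega>. ennreal (exp (\<zeta> \<omega> \<bullet> ((2 * s) *\<^sub>R h) - s * (norm h)\<^sup>2)) \<partial>P)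
         = (\<integral>\<^sup>+\<omega>. ennreal (exp (- s * (norm h)\<^sup>2)) * ennreal (exp (\<zeta> \<omega> \<bullet> ((2 * s) *\<^sub>R h))) \<partial>P)"
        by (intro nn_integral_cong) (simp add: ennreal_mult[symmetric] exp_add[symmetric])
      also have "\<dots> = ennreal (exp (- s * (norm h)\<^sup>2)) * ennreal (exp ((norm ((2 * s) *\<^sub>R h))\<^sup>2 / 2))"
        using G unfolding standard_gaussian_def by (subst nn_integral_cmult) (auto simp del: inner_scaleR_right norm_scaleR)
      also have "\<dots> = ennreal (exp (s * (2 * s - 1) * (norm h)\<^sup>2))"
        by (simp add: ennreal_mult[symmetric] exp_add[symmetric] power_mult_distrib algebra_simps power2_eq_square)
      finally show "(\<integral>\<^sup>+\<omega>. ennreal (exp (\<zeta> \<omega> \<bullet> ((2 * s) *\<^sub>R h) - s * (norm h)\<^sup>2)) \<partial>P)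
         \<le> ennreal (exp (s * (2 * s - 1) * (norm h)\<^sup>2))" by simp
    qed auto
    also have "\<dots> \<le> exp (s * (2 * s - 1) * r\<^sup>2) * exp (- c)"
      using s T(3)[OF h] by (auto intro!: mult_left_mono power_mono)
    also have "\<dots> = exp (- ln (real (card T)) - y)"
      by (simp add: c_def exp_add[symmetric])
    also have "\<dots> = exp (- y) / real (card T)"
      using N by (simp add: exp_diff exp_minus field_simps)
    finally show ?thesis .
  qed
  then have "(\<Sum>h\<in>T. prob (D h)) \<le> (\<Sum>h\<in>T. exp (- y) / real (card T))"
    by (rule sum_mono)
  moreover have "prob (\<Union>h\<in>T. D h) \<le> (\<Sum>h\<in>T. prob (D h))"
    using D by (intro finite_measure_subadditive_finite T(1)) auto
  ultimately have "prob (\<Union>h\<in>T. D h) \<le> exp (- y)"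
    using N by simp
  moreover have U: "(\<Union>h\<in>T. D h) \<in> sets P" using T(1) by auto
  ultimately have pr: "1 - exp (- y) \<le> prob (space P - (\<Union>h\<in>T. D h))"
    by (subst prob_compl) auto
  have bd: "2 * (\<zeta> \<omega> \<bullet> h) - (norm h)\<^sup>2 \<le> (ln (real (card T)) + y) / s + (2 * s - 1) * r\<^sup>2"
    if "\<omega> \<in> space P - (\<Union>h\<in>T. D h)" "h \<in> T" for \<omega> h
  proof -
    have "s * (2 * (\<zeta> \<omega> \<bullet> h) - (norm h)\<^sup>2) \<le> c"
      using that by (auto simp: D_def algebra_simps)
    then have "2 * (\<zeta> \<omega> \<bullet> h) - (norm h)\<^sup>2 \<le> c / s"
      using s by (simp add: field_simps)
    also have "c / s = (ln (real (card T)) + y) / s + (2 * s - 1) * r\<^sup>2"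
      using s by (simp add: c_def field_simps)
    finally show ?thesis .
  qed
  show thesis
    using that[OF _ pr bd] U by auto
qed

lemma exists_ge_weighted_mean:
  fixes g \<theta> :: "'i::finite \<Rightarrow> real"
  assumes "\<And>i. 0 \<le> \<theta> i" "(\<Sum>i\<in>UNIV. \<theta> i) = 1"
  shows "\<exists>i. (\<Sum>i\<in>UNIV. \<theta> i * g i) \<le> g i"
proof (rule ccontr)
  define m where "m = (\<Sum>i\<in>UNIV. \<theta> i * g i)"
  assume "\<not> ?thesis"
  then have lt: "g i < m" for i by (simp add: m_def not_le)
  obtain i where i: "0 < \<theta> i"
    using assms by (metis (full_types) less_eq_real_def sum.neutral zero_neq_one)
  have "0 < (\<Sum>i\<in>UNIV. \<theta> i * (m - g i))"
    using assms(1) i lt less_imp_le[OF lt] by (intro sum_pos2[of _ i]) simp_all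
  also have "\<dots> = (\<Sum>i\<in>UNIV. \<theta> i) * m - m"
    by (simp add: right_diff_distrib sum_subtractf m_def flip: sum_distrib_right)
  finally show False using assms(2) by simp
qed

text \<open>Maurey's sampling argument with the randomness removed.  If \<open>i\<close> is drawn with probability
\<open>\<theta> i\<close>, then \<open>v i\<close> has mean \<open>0\<close>, so adding \<open>v i\<close> to a partial sum \<open>T\<close> leaves the linear term unchanged on
average and raises \<open>|T|^2\<close> by the variance, at most \<open>V\<close>.  Some choice of \<open>i\<close> does at least as well
as the average, and \<open>k\<close> such choices lose at most \<open>a k V\<close>.  A sequence of choices is recorded by the
number \<open>n i\<close> of times that \<open>i\<close> occurs, since only this number is to be counted.\<close>

lemma maurey_greedy:
  fixes v :: "'i::finite \<Rightarrow> 'a::real_inner" and \<theta> :: "'i \<Rightarrow> real"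
  assumes \<theta>: "\<And>i. 0 \<le> \<theta> i" "(\<Sum>i\<in>UNIV. \<theta> i) = 1"
    and mean: "(\<Sum>i\<in>UNIV. \<theta> i *\<^sub>R v i) = 0"
    and var: "(\<Sum>i\<in>UNIV. \<theta> i * (norm (v i))\<^sup>2) \<le> V"
    and "0 \<le> a"
  shows "\<exists>n :: 'i \<Rightarrow> nat. sum n UNIV = k \<and>
    - (a * real k * V) \<le> b \<bullet> (\<Sum>i\<in>UNIV. real (n i) *\<^sub>R v i) - a * (norm (\<Sum>i\<in>UNIV. real (n i) *\<^sub>R v i))\<^sup>2"
proof (induction k)
  case 0
  show ?case by (intro exI[of _ "\<lambda>_. 0"]) simp
next
  case (Suc k)
  then obtain n :: "'i \<Rightarrow> nat" where n: "sum n UNIV = k"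
    "- (a * real k * V) \<le> b \<bullet> (\<Sum>i\<in>UNIV. real (n i) *\<^sub>R v i) - a * (norm (\<Sum>i\<in>UNIV. real (n i) *\<^sub>R v i))\<^sup>2"
    by blast
  define T where "T = (\<Sum>i\<in>UNIV. real (n i) *\<^sub>R v i)"
  have mean0: "(\<Sum>i\<in>UNIV. \<theta> i * (x \<bullet> v i)) = 0" for x
  proof -
    have "(\<Sum>i\<in>UNIV. \<theta> i * (x \<bullet> v i)) = x \<bullet> (\<Sum>i\<in>UNIV. \<theta> i *\<^sub>R v i)"
      by (simp add: inner_sum_right)
    then show ?thesis by (simp add: mean)
  qed
  have ex: "b \<bullet> (T + v i) - a * (norm (T + v i))\<^sup>2
      = (b \<bullet> T - a * (norm T)\<^sup>2) + ((b - (2 * a) *\<^sub>R T) \<bullet> v i) - a * (norm (v i))\<^sup>2" for i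
    by (simp add: power2_norm_eq_inner algebra_simps inner_commute)
  have "(\<Sum>i\<in>UNIV. \<theta> i * (b \<bullet> (T + v i) - a * (norm (T + v i))\<^sup>2))
      = (\<Sum>i\<in>UNIV. \<theta> i * (b \<bullet> T - a * (norm T)\<^sup>2) + \<theta> i * ((b - (2 * a) *\<^sub>R T) \<bullet> v i)
          - a * (\<theta> i * (norm (v i))\<^sup>2))"
    by (intro sum.cong refl, subst ex) (simp add: algebra_simps)
  also have "\<dots> = (b \<bullet> T - a * (norm T)\<^sup>2) - a * (\<Sum>i\<in>UNIV. \<theta> i * (norm (v i))\<^sup>2)"
    by (simp add: sum.distrib sum_subtractf mean0 \<theta>(2) flip: sum_distrib_left sum_distrib_right)
  also have "\<dots> \<ge> (b \<bullet> T - a * (norm T)\<^sup>2) - a * V"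
    using var \<open>0 \<le> a\<close> by (simp add: mult_left_mono)
  finally have "- (a * real (Suc k) * V) \<le> (\<Sum>i\<in>UNIV. \<theta> i * (b \<bullet> (T + v i) - a * (norm (T + v i))\<^sup>2))"
    using n(2) by (simp add: T_def algebra_simps)
  with exists_ge_weighted_mean[OF \<theta>, of "\<lambda>i. b \<bullet> (T + v i) - a * (norm (T + v i))\<^sup>2"]
  obtain i where i: "- (a * real (Suc k) * V) \<le> b \<bullet> (T + v i) - a * (norm (T + v i))\<^sup>2"
    by (meson order_trans)
  have "(\<Sum>j\<in>UNIV. real ((n(i := Suc (n i))) j) *\<^sub>R v j)
      = (\<Sum>j\<in>UNIV. real (n j) *\<^sub>R v j + (if j = i then v j else 0))"
    by (intro sum.cong refl) (simp add: algebra_simps)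
  then have T': "(\<Sum>j\<in>UNIV. real ((n(i := Suc (n i))) j) *\<^sub>R v j) = T + v i"
    by (simp add: sum.distrib T_def)
  have "sum (n(i := Suc (n i))) UNIV = (\<Sum>j\<in>UNIV. n j + (if j = i then 1 else 0))"
    by (intro sum.cong refl) simp
  then have "sum (n(i := Suc (n i))) UNIV = Suc k"
    by (simp add: sum.distrib n(1))
  with i T' show ?case by (intro exI[of _ "n(i := Suc (n i))"]) (simp only: simp_thms)
qed

definition average :: "('i::finite \<Rightarrow> 'a::real_vector) \<Rightarrow> nat \<Rightarrow> ('i \<Rightarrow> nat) \<Rightarrow> 'a" where
  "average f k n = (1 / real k) *\<^sub>R (\<Sum>i\<in>UNIV. real (n i) *\<^sub>R f i)"

text \<open>With \<open>u + T\<close> the average, where \<open>T\<close> is \<open>1 / k\<close> times a sum of \<open>k\<close> centred dictionary elements, the functional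
at \<open>u + T\<close> exceeds its value at \<open>u\<close> by \<open>2 ((z - (u - c)) \<bullet> T) - |T|^2\<close>.  The greedy choice, with weights
\<open>a = 1 / k^2\<close> and \<open>b = (2 / k) (z - (u - c))\<close>, makes this at least \<open>- \<rho>^2 / k\<close>.\<close>

lemma maurey:
  fixes f :: "'i::finite \<Rightarrow> 'a::real_inner" and \<theta> :: "'i \<Rightarrow> real"
  assumes \<theta>: "\<And>i. 0 \<le> \<theta> i" "(\<Sum>i\<in>UNIV. \<theta> i) = 1"
    and f: "\<And>i. norm (f i) \<le> \<rho>" and k: "0 < k" and u: "u = (\<Sum>i\<in>UNIV. \<theta> i *\<^sub>R f i)"
  shows "\<exists>n. sum n UNIV = k \<and>
    2 * (z \<bullet> (u - c)) - (norm (u - c))\<^sup>2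
      \<le> 2 * (z \<bullet> (average f k n - c)) - (norm (average f k n - c))\<^sup>2 + \<rho>\<^sup>2 / real k"
proof -
  define v where "v i = f i - u" for i
  define b where "b = (2 / real k) *\<^sub>R (z - (u - c))"
  have mean: "(\<Sum>i\<in>UNIV. \<theta> i *\<^sub>R v i) = 0"
    using \<theta>(2) by (simp add: v_def scaleR_diff_right sum_subtractf u flip: scaleR_sum_left)
  have uu: "(\<Sum>i\<in>UNIV. \<theta> i * (f i \<bullet> u)) = u \<bullet> u"
    unfolding u by (simp add: inner_sum_left)
  have "(\<Sum>i\<in>UNIV. \<theta> i * (norm (v i))\<^sup>2)
      = (\<Sum>i\<in>UNIV. \<theta> i * (norm (f i))\<^sup>2 - 2 * (\<theta> i * (f i \<bullet> u)) + \<theta> i * (u \<bullet> u))"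
    by (intro sum.cong refl)
      (simp add: v_def power2_norm_eq_inner inner_diff_left inner_diff_right inner_commute algebra_simps)
  also have "\<dots> = (\<Sum>i\<in>UNIV. \<theta> i * (norm (f i))\<^sup>2) - u \<bullet> u"
    by (simp add: sum.distrib sum_subtractf uu \<theta>(2) flip: sum_distrib_left sum_distrib_right)
  also have "\<dots> \<le> (\<Sum>i\<in>UNIV. \<theta> i * \<rho>\<^sup>2)"
  proof -
    have "(\<Sum>i\<in>UNIV. \<theta> i * (norm (f i))\<^sup>2) \<le> (\<Sum>i\<in>UNIV. \<theta> i * \<rho>\<^sup>2)"
      using \<theta>(1) f by (intro sum_mono mult_left_mono power_mono) auto
    then show ?thesis using inner_ge_zero[of u] by linarith
  qed
  also have "\<dots> = \<rho>\<^sup>2" by (simp add: \<theta>(2) flip: sum_distrib_right)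
  finally obtain n where n: "sum n UNIV = k"
    and le: "- (1 / (real k)\<^sup>2 * real k * \<rho>\<^sup>2) \<le> b \<bullet> (\<Sum>i\<in>UNIV. real (n i) *\<^sub>R v i)
        - 1 / (real k)\<^sup>2 * (norm (\<Sum>i\<in>UNIV. real (n i) *\<^sub>R v i))\<^sup>2"
    using maurey_greedy[OF \<theta> mean, of "\<rho>\<^sup>2" "1 / (real k)\<^sup>2" k b] by auto
  define T where "T = (1 / real k) *\<^sub>R (\<Sum>i\<in>UNIV. real (n i) *\<^sub>R v i)"
  have "(\<Sum>i\<in>UNIV. real (n i)) = real k" using n by (simp flip: of_nat_sum)
  then have avg: "average f k n - c = (u - c) + T"
    using k by (simp add: average_def T_def v_def scaleR_diff_right sum_subtractf flip: scaleR_sum_left)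
  have "- (\<rho>\<^sup>2 / real k) \<le> 2 * ((z - (u - c)) \<bullet> T) - (norm T)\<^sup>2"
    using le k by (simp add: T_def b_def power_divide power2_eq_square)
  then have "2 * (z \<bullet> (u - c)) - (norm (u - c))\<^sup>2
      \<le> 2 * (z \<bullet> (average f k n - c)) - (norm (average f k n - c))\<^sup>2 + \<rho>\<^sup>2 / real k"
    unfolding avg by (simp add: power2_norm_eq_inner algebra_simps inner_commute)
  with n show ?thesis by blast
qed

text \<open>Listing the values of \<open>n\<close> along an enumeration of the index type turns these functions into lists
of fixed length and sum, which stars and bars counts.\<close>

lemma card_count_vectors:
  "finite {n :: 'i::finite \<Rightarrow> nat. sum n UNIV = k}"
  "card {n :: 'i::finite \<Rightarrow> nat. sum n UNIV = k} \<le> (k + CARD('i) - 1) choose k"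
proof -
  obtain xs :: "'i list" where xs: "set xs = UNIV" "distinct xs"
    using finite_distinct_list[OF finite] by blast
  have len: "length xs = CARD('i)" using xs by (metis distinct_card)
  let ?C = "{n :: 'i \<Rightarrow> nat. sum n UNIV = k}"
  let ?L = "{l :: nat list. size l = CARD('i) \<and> sum_list l = k}"
  have inj: "inj_on (\<lambda>n. map n xs) ?C"
    using xs(1) by (auto simp: inj_on_def fun_eq_iff)
  have sub: "(\<lambda>n. map n xs) ` ?C \<subseteq> ?L"
    using xs len by (auto simp: sum_list_distinct_conv_sum_set)
  have "?L \<subseteq> {l. set l \<subseteq> {..k} \<and> length l = CARD('i)}"
    using member_le_sum_list by fastforce
  then have fin: "finite ?L"
    by (rule finite_subset) (simp add: finite_lists_length_eq)
  show "finite ?C" using inj sub fin by (rule inj_on_finite)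
  show "card ?C \<le> (k + CARD('i) - 1) choose k"
    using card_inj_on_le[OF inj sub fin] by (simp only: card_length_sum_list)
qed

text \<open>The left side divided by \<open>fact k\<close> is one term of the exponential series at \<open>k\<close>.\<close>

lemma power_self_le_exp_fact: "real k ^ k \<le> exp (real k) * fact k"
proof -
  have "(\<Sum>n\<in>{k}. real k ^ n /\<^sub>R fact n) \<le> (\<Sum>n. real k ^ n /\<^sub>R fact n)"
    by (intro sum_le_suminf summable_exp_generic) auto
  then show ?thesis by (simp add: exp_def field_simps)
qed

text \<open>The usual bound \<open>(e N / k)^k\<close> on \<open>N choose k\<close>.  Counting unordered samples is essential: the
bound \<open>M^k\<close> on ordered ones would cost \<open>k ln M\<close>, too much when \<open>k\<close> is comparable to \<open>M\<close> or larger.\<close>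

lemma ln_card_count_vectors_le:
  assumes "0 < k"
  shows "ln (real (card {n :: 'i::finite \<Rightarrow> nat. sum n UNIV = k}))
    \<le> real k * (1 + ln (1 + real CARD('i) / real k))"
proof -
  define M where "M = CARD('i)"
  have M: "0 < M" by (simp add: M_def)
  define C where "C = (k + M - 1) choose k"
  have "k \<le> k + M - 1" using M by simp
  then have C: "0 < C" by (simp add: C_def)
  have "real C * fact k \<le> real (k + M - 1) ^ k"
  proof -
    have "C * fact k \<le> (k + M - 1) ^ k" unfolding C_def by (rule binomial_fact_pow)
    then have "real (C * fact k) \<le> real ((k + M - 1) ^ k)" by (simp only: of_nat_le_iff)
    then show ?thesis by simp
  qed
  also have "\<dots> \<le> (real k + real M) ^ k"
    using M by (intro power_mono) auto
  finally have 1: "real C * fact k \<le> (real k + real M) ^ k" .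
  have "real C * real k ^ k \<le> real C * (exp (real k) * fact k)"
    using power_self_le_exp_fact by (intro mult_left_mono) auto
  also have "\<dots> \<le> exp (real k) * (real k + real M) ^ k"
    using 1 by simp
  also have "(real k + real M) ^ k = real k ^ k * (1 + real M / real k) ^ k"
    using assms by (simp add: field_simps flip: power_mult_distrib)
  finally have "real C \<le> exp (real k) * (1 + real M / real k) ^ k"
    using assms by simp
  then have "ln (real C) \<le> ln (exp (real k) * (1 + real M / real k) ^ k)"
    using C by (intro ln_mono) auto
  also have "\<dots> = real k * (1 + ln (1 + real M / real k))"
    using add_pos_nonneg[of 1 "real M / real k"] by (simp add: ln_mult ln_realpow algebra_simps)
  finally have 2: "ln (real C) \<le> real k * (1 + ln (1 + real M / real k))" .
  have "{n :: 'i \<Rightarrow> nat. sum n UNIV = k} \<noteq> {}"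
  proof -
    have "(\<lambda>i. if i = undefined then k else 0) \<in> {n :: 'i \<Rightarrow> nat. sum n UNIV = k}" by simp
    then show ?thesis by blast
  qed
  then have "0 < card {n :: 'i \<Rightarrow> nat. sum n UNIV = k}"
    using card_count_vectors(1)[where 'i='i] by (simp add: card_gt_0_iff)
  then have "ln (real (card {n :: 'i \<Rightarrow> nat. sum n UNIV = k})) \<le> ln (real C)"
    using card_count_vectors(2)[where 'i='i, of k] by (intro ln_mono) (simp_all add: C_def M_def)
  with 2 show ?thesis by (simp add: M_def)
qed

section \<open>Noise over the convex hull\<close>

text \<open>For \<open>k\<close> at least half the optimal size \<open>\<rho> / sqrt L\<close>, the entropy per sampled element is a multiple of
\<open>L\<close>.  With \<open>q = 2 M / \<rho>\<close> the ratio \<open>M / k\<close> is at most \<open>q sqrt L\<close>; the factor \<open>sqrt L\<close> adds only \<open>ln L / 2\<close>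
to the logarithm.  The truncation of \<open>L\<close> at \<open>1\<close> covers the case \<open>q \<le> 1\<close>.\<close>

lemma ln_entropy_le:
  assumes "0 < \<rho>" "1 \<le> M" and L: "L = log_plus (exp 1 * M / (\<rho> / 2))"
    and k: "\<rho> / (2 * sqrt L) \<le> k" "0 < k"
  shows "1 + ln (1 + M / k) \<le> 5 / 2 * L"
proof -
  have L1: "1 \<le> L" by (simp add: L log_plus_def)
  define q where "q = 2 * M / \<rho>"
  have q: "0 < q" using assms by (simp add: q_def)
  have qL: "1 + ln q \<le> L"
  proof -
    have "exp 1 * M / (\<rho> / 2) = exp 1 * q" by (simp add: q_def)
    then have "ln (exp 1 * M / (\<rho> / 2)) = 1 + ln q" using q by (simp add: ln_mult)
    then show ?thesis by (simp add: L log_plus_def)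
  qed
  have s: "1 \<le> sqrt L" using L1 by simp
  have "M / k \<le> M / (\<rho> / (2 * sqrt L))"
    using assms s by (intro divide_left_mono) auto
  also have "\<dots> = q * sqrt L" by (simp add: q_def)
  finally have "1 + M / k \<le> sqrt L * (1 + q)"
    using s unfolding distrib_left by (simp only: mult.commute mult_1_right)
  then have "ln (1 + M / k) \<le> ln (sqrt L * (1 + q))"
    using assms by (intro ln_mono) (auto intro!: add_pos_nonneg)
  also have "\<dots> = ln L / 2 + ln (1 + q)"
    using L1 q by (simp add: ln_mult ln_sqrt)
  finally have "ln (1 + M / k) \<le> ln L / 2 + ln (1 + q)" .
  moreover have "ln L \<le> L - 1" using L1 by (intro ln_le_minus_one) simp
  moreover have "ln (1 + q) \<le> L"
  proof (cases "q \<le> 1")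
    case True
    then have "ln (1 + q) \<le> q" using q by (intro ln_add_one_self_le_self) auto
    then show ?thesis using True L1 by linarith
  next
    case False
    then have "ln (1 + q) \<le> ln (2 * q)" using q by simp
    also have "\<dots> = ln 2 + ln q" using q by (simp add: ln_mult)
    also have "ln 2 \<le> (1::real)" using ln_le_minus_one[of "2::real"] by simp
    finally show ?thesis using qL by simp
  qed
  ultimately show ?thesis using L1 by linarith
qed

text \<open>The number \<open>k\<close> of samples should be close to \<open>\<rho> / s\<close>, where \<open>s = sqrt L\<close>: the Maurey error \<open>\<rho>^2 / k\<close> and the
entropy \<open>k L\<close> are then both of order \<open>\<rho> s\<close>.  If \<open>\<rho> \<ge> s\<close>, its integer part works, with Chernoff parameter
\<open>l = 1 / 2\<close>.  If \<open>\<rho> < s\<close>, a single sample has to do, and the larger parameter \<open>l = s / \<rho>\<close> reduces the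
entropy term to order \<open>L / l = \<rho> s\<close>.  The contributions are \<open>2\<close> (Maurey), \<open>5\<close> (entropy) and \<open>8\<close>
(variance) times \<open>\<rho> s\<close>, and their sum is below \<open>31\<close>.\<close>

lemma hull_noise_bound:
  fixes \<zeta> :: "'w \<Rightarrow> 'a::euclidean_space" and f :: "'i::finite \<Rightarrow> 'a"
  assumes P: "prob_space P" and G: "standard_gaussian P \<zeta>"
    and f: "\<And>i. norm (f i) \<le> \<rho>" and \<rho>: "0 < \<rho>" and c: "norm c \<le> \<rho>" and x: "0 < x"
    and L: "L = log_plus (exp 1 * real CARD('i) / (\<rho> / 2))"
  obtains A where "A \<in> sets P" "1 - exp (- x) < measure P A"
    "\<And>\<omega> \<theta> u. \<omega> \<in> A \<Longrightarrow> (\<And>i. 0 \<le> \<theta> i) \<Longrightarrow> (\<Sum>i\<in>UNIV. \<theta> i) = 1 \<Longrightarrow> u = (\<Sum>i\<in>UNIV. \<theta> i *\<^sub>R f i) \<Longrightarrow>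
      2 * (\<zeta> \<omega> \<bullet> (u - c)) - (norm (u - c))\<^sup>2 \<le> 31 * \<rho> * sqrt L + 4 * x"
proof -
  define s where "s = sqrt L"
  have L1: "1 \<le> L" by (simp add: L log_plus_def)
  then have s1: "1 \<le> s" and sL: "s * s = L" by (auto simp: s_def)
  obtain k :: nat and l :: real where k: "0 < k" "\<rho> / (2 * s) \<le> real k"
    and l: "1 / 2 \<le> l" "real k * s / l \<le> 2 * \<rho>" "(2 * l - 1) * \<rho> \<le> 2 * s"
  proof (cases "\<rho> < s")
    case True
    show thesis
    proof (rule that[of 1 "s / \<rho>"])
      show "\<rho> / (2 * s) \<le> real 1" using True \<rho> s1 by (simp add: field_simps)
      show "1 / 2 \<le> s / \<rho>" using True \<rho> by (simp add: field_simps)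
      show "real 1 * s / (s / \<rho>) \<le> 2 * \<rho>" using \<rho> s1 by simp
      show "(2 * (s / \<rho>) - 1) * \<rho> \<le> 2 * s" using \<rho> by (simp add: field_simps)
    qed simp
  next
    case False
    define r where "r = \<rho> / s"
    have r: "1 \<le> r" using False s1 by (simp add: r_def)
    define k where "k = nat \<lfloor>r\<rfloor>"
    have kr: "real k \<le> r" "r < real k + 1" using r by (auto simp: k_def)
    have "1 \<le> k" using r by (simp add: k_def le_nat_iff)
    then have k1: "1 \<le> real k" by simp
    show thesis
    proof (rule that[of k "1 / 2"])
      show "0 < k" using \<open>1 \<le> k\<close> by simp
      show "\<rho> / (2 * s) \<le> real k" using kr k1 by (simp add: r_def)
      have "real k * s \<le> r * s" using kr s1 by (intro mult_right_mono) auto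
      also have "\<dots> = \<rho>" using s1 by (simp add: r_def)
      finally show "real k * s / (1 / 2) \<le> 2 * \<rho>" by simp
      show "(2 * (1 / 2) - 1) * \<rho> \<le> 2 * s" using s1 by simp
    qed simp
  qed
  define N where "N = {n :: 'i \<Rightarrow> nat. sum n UNIV = k}"
  define T where "T = (\<lambda>n. average f k n - c) ` N"
  have finN: "finite N" unfolding N_def by (rule card_count_vectors)
  have "(\<lambda>i. if i = undefined then k else 0) \<in> N" by (simp add: N_def)
  then have T: "finite T" "T \<noteq> {}" using finN by (auto simp: T_def)
  have Tn: "norm h \<le> 2 * \<rho>" if h: "h \<in> T" for h
  proof -
    obtain n where n: "sum n UNIV = k" "h = average f k n - c" using h by (auto simp: T_def N_def)
    have "norm (\<Sum>i\<in>UNIV. real (n i) *\<^sub>R f i) \<le> (\<Sum>i\<in>UNIV. real (n i) * \<rho>)"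
      using f by (intro sum_norm_le) (auto intro: mult_left_mono)
    also have "\<dots> = real k * \<rho>" using n(1) by (simp flip: sum_distrib_right of_nat_sum)
    finally have "norm (average f k n) \<le> \<rho>"
      using k(1) by (simp add: average_def field_simps)
    then show ?thesis using c norm_triangle_ineq4[of "average f k n" c] unfolding n(2) by linarith
  qed
  \<comment> \<open>Confidence level \<open>2 x\<close> costs \<open>2 x / l \<le> 4 x\<close> and makes the final probability bound strict.\<close>
  obtain A where A: "A \<in> sets P" "1 - exp (- (2 * x)) \<le> measure P A"
    "\<And>\<omega> h. \<omega> \<in> A \<Longrightarrow> h \<in> T \<Longrightarrow>
      2 * (\<zeta> \<omega> \<bullet> h) - (norm h)\<^sup>2 \<le> (ln (real (card T)) + 2 * x) / l + (2 * l - 1) * (2 * \<rho>)\<^sup>2"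
    using finite_noise_bound[OF P G T Tn l(1)] by metis
  have "ln (real (card T)) \<le> real k * (5 / 2 * L)"
  proof -
    have "0 < card T" "card T \<le> card N"
      using T finN by (auto simp: card_gt_0_iff T_def card_image_le)
    then have "ln (real (card T)) \<le> ln (real (card N))" by simp
    also have "\<dots> \<le> real k * (1 + ln (1 + real CARD('i) / real k))"
      unfolding N_def by (rule ln_card_count_vectors_le[OF k(1)])
    also have "\<dots> \<le> real k * (5 / 2 * L)"
      using k by (intro mult_left_mono ln_entropy_le[OF \<rho> _ L]) (auto simp: s_def Suc_leI)
    finally show ?thesis .
  qed
  then have "ln (real (card T)) / l \<le> real k * (5 / 2 * L) / l"
    using l(1) by (intro divide_right_mono) auto
  also have "\<dots> = (real k * s / l) * (5 / 2 * s)" by (simp add: sL[symmetric])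
  also have "\<dots> \<le> (2 * \<rho>) * (5 / 2 * s)" using l(2) s1 by (intro mult_right_mono) auto
  finally have b1: "ln (real (card T)) / l \<le> 5 * \<rho> * s" by simp
  have b2: "2 * x / l \<le> 4 * x" using l(1) x by (simp add: field_simps)
  have "(2 * l - 1) * (2 * \<rho>)\<^sup>2 = ((2 * l - 1) * \<rho>) * (4 * \<rho>)"
    by (simp add: power2_eq_square)
  also have "\<dots> \<le> (2 * s) * (4 * \<rho>)" using l(3) \<rho> by (intro mult_right_mono) auto
  finally have b3: "(2 * l - 1) * (2 * \<rho>)\<^sup>2 \<le> 8 * \<rho> * s" by simp
  have b4: "\<rho>\<^sup>2 / real k \<le> 2 * \<rho> * s"
    using k s1 \<rho> by (simp add: field_simps power2_eq_square)
  have "exp (- (2 * x)) < exp (- x)" using x by simp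
  then have pr: "1 - exp (- x) < measure P A" using A(2) by linarith
  show thesis
  proof (rule that[OF A(1) pr])
    fix \<omega> \<theta> u
    assume \<omega>: "\<omega> \<in> A" and \<theta>: "\<And>i. 0 \<le> \<theta> i" "(\<Sum>i\<in>UNIV. \<theta> i) = 1" and u: "u = (\<Sum>i\<in>UNIV. \<theta> i *\<^sub>R f i)"
    obtain n where n: "sum n UNIV = k"
      "2 * (\<zeta> \<omega> \<bullet> (u - c)) - (norm (u - c))\<^sup>2
      \<le> 2 * (\<zeta> \<omega> \<bullet> (average f k n - c)) - (norm (average f k n - c))\<^sup>2 + \<rho>\<^sup>2 / real k"
      using maurey[OF \<theta> f k(1) u] by blast
    have "average f k n - c \<in> T" using n(1) by (auto simp: T_def N_def)
    note A(3)[OF \<omega> this]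
    moreover have "0 \<le> \<rho> * s" using \<rho> s1 by simp
    ultimately show "2 * (\<zeta> \<omega> \<bullet> (u - c)) - (norm (u - c))\<^sup>2 \<le> 31 * \<rho> * sqrt L + 4 * x"
      using n(2) b1 b2 b3 b4 unfolding add_divide_distrib s_def[symmetric] by linarith
  qed
qed

section \<open>From the estimator to the noise\<close>

text \<open>The angle at the projection \<open>u\<close> of \<open>f0 + \<xi>\<close> between the data and any other point \<open>c\<close> of \<open>K\<close> is at
least a right angle.
Strong convexity of the squared distance is what produces the term \<open>- |u - c|^2\<close>.\<close>

lemma basic_inequality:
  fixes \<xi> :: "'a::euclidean_space"
  assumes "convex K" "closed K" "c \<in> K" and u: "u = closest_point K (f0 + \<xi>)"
  shows "(norm (u - f0))\<^sup>2 \<le> (norm (c - f0))\<^sup>2 + (2 * (\<xi> \<bullet> (u - c)) - (norm (u - c))\<^sup>2)"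
proof -
  have "(f0 + \<xi> - u) \<bullet> (c - u) \<le> 0"
    unfolding u by (rule closest_point_dot[OF assms(1-3)])
  then show ?thesis
    by (simp add: power2_norm_eq_inner algebra_simps inner_commute)
qed

section \<open>The dictionary\<close>

lemma linear_lin_comb: "linear (lin_comb f)"
  by (rule linearI) (simp_all add: lin_comb_def sum.distrib scaleR_left_distrib scaleR_sum_right)

lemma convex_prob_simplex: "convex (prob_simplex :: (real ^ 'm::finite) set)"
  by (rule convexI) (auto simp: prob_simplex_def sum.distrib simp flip: sum_distrib_left)

lemma compact_prob_simplex: "compact (prob_simplex :: (real ^ 'm::finite) set)"
proof (rule compact_eq_bounded_closed[THEN iffD2], intro conjI)
  have "norm \<theta> \<le> 1" if "\<theta> \<in> prob_simplex" for \<theta> :: "real ^ 'm"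
    using norm_le_l1_cart[of \<theta>] that by (simp add: prob_simplex_def)
  then show "bounded (prob_simplex :: (real ^ 'm) set)" by (auto simp: bounded_iff)
  have "closed ({\<theta>. (\<Sum>j\<in>UNIV. \<theta> $ j) = 1} \<inter> (\<Inter>j. {\<theta> :: real ^ 'm. 0 \<le> \<theta> $ j}))"
    by (intro closed_Int closed_INT ballI closed_Collect_eq closed_Collect_le continuous_intros)
  also have "{\<theta>. (\<Sum>j\<in>UNIV. \<theta> $ j) = 1} \<inter> (\<Inter>j. {\<theta> :: real ^ 'm. 0 \<le> \<theta> $ j}) = prob_simplex"
    by (auto simp: prob_simplex_def)
  finally show "closed (prob_simplex :: (real ^ 'm) set)" .
qed

lemma prob_simplex_nonempty: "(prob_simplex :: (real ^ 'm::finite) set) \<noteq> {}"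
proof -
  have "axis undefined 1 \<in> (prob_simplex :: (real ^ 'm) set)"
    by (simp add: prob_simplex_def axis_def)
  then show ?thesis by blast
qed

lemma norm_lin_comb_le:
  assumes "\<theta> \<in> prob_simplex" "\<And>j. norm (f j) \<le> r"
  shows "norm (lin_comb f \<theta>) \<le> r"
proof -
  have "norm (lin_comb f \<theta>) \<le> (\<Sum>j\<in>UNIV. \<theta> $ j * r)"
    unfolding lin_comb_def
    using assms by (intro sum_norm_le) (auto simp: prob_simplex_def intro: mult_left_mono)
  also have "\<dots> = r"
    using assms(1) by (simp add: prob_simplex_def flip: sum_distrib_right)
  finally show ?thesis .
qed

lemma dict_radius_nonneg:
  fixes f :: "'m::finite \<Rightarrow> real ^ 'n::finite"
  shows "0 \<le> dict_radius f"
proof -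
  have "0 \<le> 1 / real CARD('n) * (norm (f undefined))\<^sup>2" by simp
  also have "\<dots> \<le> Max (range (\<lambda>j. 1 / real CARD('n) * (norm (f j))\<^sup>2))"
    by (intro Max_ge) auto
  finally show ?thesis by (simp add: dict_radius_def)
qed

lemma norm_le_dict_radius:
  fixes f :: "'m::finite \<Rightarrow> real ^ 'n::finite"
  shows "norm (f j) \<le> 2 * dict_radius f * sqrt (real CARD('n))"
proof -
  define m where "m = Max (range (\<lambda>j. 1 / real CARD('n) * (norm (f j))\<^sup>2))"
  have m: "1 / real CARD('n) * (norm (f j))\<^sup>2 \<le> m" unfolding m_def by (intro Max_ge) auto
  moreover have "0 \<le> 1 / real CARD('n) * (norm (f j))\<^sup>2" by simp
  ultimately have "0 \<le> m" by linarith
  then have "(dict_radius f)\<^sup>2 = m / 4" by (simp add: dict_radius_def m_def)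
  then have "(norm (f j))\<^sup>2 \<le> (2 * dict_radius f * sqrt (real CARD('n)))\<^sup>2"
    using m by (simp add: power_mult_distrib field_simps)
  then show ?thesis
    by (rule power2_le_imp_le) (simp add: dict_radius_nonneg)
qed

lemma tstar_sq_nonneg: "0 \<le> \<sigma> \<Longrightarrow> 0 \<le> R \<Longrightarrow> 0 \<le> tstar_sq \<sigma> n M R"
  by (simp add: tstar_sq_def log_plus_def)

section \<open>The oracle inequality\<close>

text \<open>The rate is a minimum, and whichever term attains it decides which of the two bounds on the
noise is used; \<open>\<rho>\<close> is here \<open>2 R sqrt n / \<sigma>\<close>, the bound on the norms of the rescaled dictionary.  For \<open>R = 0\<close>
the dictionary, hence its hull, is zero, and there is nothing to bound.\<close>

lemma dictionary_noise_bound: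
  fixes \<xi> :: "'w \<Rightarrow> real ^ 'n::finite" and f :: "'m::finite \<Rightarrow> real ^ 'n"
  assumes P: "prob_space P" and \<sigma>: "0 < \<sigma>" and G: "isotropic_gaussian P \<sigma> \<xi>"
    and c: "c \<in> lin_comb f ` prob_simplex" and x: "0 < x"
  obtains A where "A \<in> sets P" "1 - exp (- x) < measure P A"
    "\<And>\<omega> u. \<omega> \<in> A \<Longrightarrow> u \<in> lin_comb f ` prob_simplex \<Longrightarrow>
      2 * (\<xi> \<omega> \<bullet> (u - c)) - (norm (u - c))\<^sup>2
        \<le> real CARD('n) * (2 * tstar_sq \<sigma> CARD('n) CARD('m) (dict_radius f)) + 4 * \<sigma>\<^sup>2 * x"
proof -
  interpret prob_space P by fact
  define \<zeta> where "\<zeta> \<omega> = \<xi> \<omega> /\<^sub>R \<sigma>" for \<omega>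
  have \<zeta>: "standard_gaussian P \<zeta>"
    unfolding \<zeta>_def[abs_def] by (rule isotropic_gaussian_standardize[OF P \<sigma> G])
  have rescale: "2 * (\<xi> \<omega> \<bullet> h) - (norm h)\<^sup>2 = \<sigma>\<^sup>2 * (2 * (\<zeta> \<omega> \<bullet> (h /\<^sub>R \<sigma>)) - (norm (h /\<^sub>R \<sigma>))\<^sup>2)" for \<omega> h
    using \<sigma> by (simp add: \<zeta>_def power_mult_distrib field_simps power2_eq_square)
  define n where "n = real CARD('n)"
  have n: "0 < n" by (simp add: n_def)
  define R where "R = dict_radius f"
  define t where "t = tstar_sq \<sigma> CARD('n) CARD('m) R"
  define L where "L = log_plus (exp 1 * real CARD('m) * \<sigma> / (R * sqrt n))"
  have norm_f: "norm (f j) \<le> 2 * R * sqrt n" for j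
    unfolding R_def n_def by (rule norm_le_dict_radius)
  have R0: "0 \<le> R" unfolding R_def by (rule dict_radius_nonneg)
  have "t = 4 * \<sigma>\<^sup>2 * real CARD('m) / n \<or> t = 31 * \<sigma> * R * sqrt L / sqrt n"
    by (simp add: t_def tstar_sq_def L_def n_def min_def)
  with R0 consider "R = 0" | "0 < R" "t = 4 * \<sigma>\<^sup>2 * real CARD('m) / n"
    | "0 < R" "t = 31 * \<sigma> * R * sqrt L / sqrt n"
    by (auto simp: less_le)
  then have "\<exists>A\<in>sets P. 1 - exp (- x) < prob A \<and> (\<forall>\<omega>\<in>A. \<forall>u\<in>lin_comb f ` prob_simplex.
      2 * (\<xi> \<omega> \<bullet> (u - c)) - (norm (u - c))\<^sup>2 \<le> n * (2 * t) + 4 * \<sigma>\<^sup>2 * x)"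
  proof cases
    case 1
    have "f j = 0" for j using norm_f[of j] 1 by simp
    then have z: "lin_comb f \<theta> = 0" for \<theta>
      by (simp add: lin_comb_def)
    have "0 \<le> n * (2 * t)" using n R0 \<sigma> by (simp add: t_def tstar_sq_nonneg)
    then show ?thesis
      using c x \<sigma> by (intro bexI[of _ "space P"]) (auto simp: z prob_space)
  next
    case 2
    have sub: "subspace (span (range f))" by simp
    have "dim (span (range f)) \<le> card (range f)" by (simp add: dim_le_card')
    also have "\<dots> \<le> CARD('m)" by (rule card_image_le) simp
    finally obtain A where A: "A \<in> sets P" "1 - exp (- x) < prob A"
      "\<And>\<omega> h. \<omega> \<in> A \<Longrightarrow> h \<in> span (range f) \<Longrightarrow>
        2 * (\<zeta> \<omega> \<bullet> h) - (norm h)\<^sup>2 \<le> 8 * real CARD('m) + 4 * x"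
      using subspace_noise_bound[OF P \<zeta> sub, of "CARD('m)" x] by (metis zero_less_card_finite)
    have K: "lin_comb f ` prob_simplex \<subseteq> span (range f)"
      by (auto simp: lin_comb_def intro!: span_sum span_scale intro: span_base)
    have "2 * (\<xi> \<omega> \<bullet> (u - c)) - (norm (u - c))\<^sup>2 \<le> n * (2 * t) + 4 * \<sigma>\<^sup>2 * x"
      if "\<omega> \<in> A" "u \<in> lin_comb f ` prob_simplex" for \<omega> u
    proof -
      have "(u - c) /\<^sub>R \<sigma> \<in> span (range f)"
        using K c that by (intro span_scale span_diff) auto
      from A(3)[OF that(1) this]
      have "2 * (\<xi> \<omega> \<bullet> (u - c)) - (norm (u - c))\<^sup>2 \<le> \<sigma>\<^sup>2 * (8 * real CARD('m) + 4 * x)"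
        unfolding rescale by (rule mult_left_mono) simp
      also have "\<dots> = n * (2 * t) + 4 * \<sigma>\<^sup>2 * x"
        using n by (simp add: 2 field_simps)
      finally show ?thesis .
    qed
    with A show ?thesis by blast
  next
    case 3
    define \<rho> where "\<rho> = 2 * R * sqrt n / \<sigma>"
    have \<rho>: "0 < \<rho>" using 3 n \<sigma> by (simp add: \<rho>_def)
    have f': "norm (f j /\<^sub>R \<sigma>) \<le> \<rho>" for j
      using norm_f[of j] \<sigma> by (simp add: \<rho>_def field_simps)
    have "norm c \<le> 2 * R * sqrt n" using c norm_f by (auto intro: norm_lin_comb_le)
    then have c': "norm (c /\<^sub>R \<sigma>) \<le> \<rho>" using \<sigma> by (simp add: \<rho>_def field_simps)
    have L: "L = log_plus (exp 1 * real CARD('m) / (\<rho> / 2))"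
      using \<sigma> by (simp add: L_def \<rho>_def)
    obtain A where A: "A \<in> sets P" "1 - exp (- x) < prob A"
      "\<And>\<omega> \<theta> u. \<omega> \<in> A \<Longrightarrow> (\<And>j. 0 \<le> \<theta> j) \<Longrightarrow> (\<Sum>j\<in>UNIV. \<theta> j) = 1 \<Longrightarrow> u = (\<Sum>j\<in>UNIV. \<theta> j *\<^sub>R (f j /\<^sub>R \<sigma>)) \<Longrightarrow>
        2 * (\<zeta> \<omega> \<bullet> (u - c /\<^sub>R \<sigma>)) - (norm (u - c /\<^sub>R \<sigma>))\<^sup>2 \<le> 31 * \<rho> * sqrt L + 4 * x"
      using hull_noise_bound[where f = "\<lambda>j. f j /\<^sub>R \<sigma>", OF P \<zeta> f' \<rho> c' x L] by blast
    have "2 * (\<xi> \<omega> \<bullet> (u - c)) - (norm (u - c))\<^sup>2 \<le> n * (2 * t) + 4 * \<sigma>\<^sup>2 * x"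
      if \<omega>: "\<omega> \<in> A" and u: "u \<in> lin_comb f ` prob_simplex" for \<omega> u
    proof -
      obtain \<theta> where \<theta>: "\<theta> \<in> prob_simplex" "u = lin_comb f \<theta>" using u by blast
      have "2 * (\<zeta> \<omega> \<bullet> (u /\<^sub>R \<sigma> - c /\<^sub>R \<sigma>)) - (norm (u /\<^sub>R \<sigma> - c /\<^sub>R \<sigma>))\<^sup>2 \<le> 31 * \<rho> * sqrt L + 4 * x"
        using \<theta> by (intro A(3)[OF \<omega>, of "\<lambda>j. \<theta> $ j"])
          (auto simp: prob_simplex_def lin_comb_def scaleR_sum_right mult.commute)
      then have "2 * (\<xi> \<omega> \<bullet> (u - c)) - (norm (u - c))\<^sup>2 \<le> \<sigma>\<^sup>2 * (31 * \<rho> * sqrt L + 4 * x)"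
        unfolding rescale scaleR_diff_right by (rule mult_left_mono) simp
      also have "\<dots> = n * (2 * t) + 4 * \<sigma>\<^sup>2 * x"
      proof -
        have "n * (2 * t) = 62 * \<sigma> * R * sqrt L * (n / sqrt n)"
          by (simp add: 3)
        then have "n * (2 * t) = 62 * \<sigma> * R * sqrt L * sqrt n"
          using n by (simp only: real_div_sqrt less_imp_le)
        moreover have "\<sigma>\<^sup>2 * (31 * \<rho> * sqrt L) = 62 * \<sigma> * R * sqrt L * sqrt n"
          using \<sigma> by (simp add: \<rho>_def power2_eq_square)
        ultimately show ?thesis by (simp only: distrib_left mult_ac)
      qed
      finally show ?thesis .
    qed
    with A show ?thesis by blast
  qed
  then show thesis
    using that unfolding n_def t_def R_def by blast
qed

theorem theorem6:
  fixes P :: "'w measure"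
    and \<sigma> :: real
    and f0 :: "real ^ 'n::finite"
    and \<xi> y :: "'w \<Rightarrow> real ^ 'n"
    and f :: "'m::finite \<Rightarrow> real ^ 'n"
    and \<theta>hat :: "'w \<Rightarrow> real ^ 'm"
  assumes "prob_space P"
    and "0 < \<sigma>"
    and "CARD('m) \<ge> 2"
    and "isotropic_gaussian P \<sigma> \<xi>"
    and "\<And>\<omega>. \<omega> \<in> space P \<Longrightarrow> y \<omega> = f0 + \<xi> \<omega>"
    and "\<And>\<omega>. \<omega> \<in> space P \<Longrightarrow>
           is_arg_min (\<lambda>\<theta>. (norm (lin_comb f \<theta> - y \<omega>))\<^sup>2) (\<lambda>\<theta>. \<theta> \<in> prob_simplex) (\<theta>hat \<omega>)"
  shows "\<forall>x>0. measure P {\<omega> \<in> space P.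
           1 / real CARD('n) * (norm (lin_comb f (\<theta>hat \<omega>) - f0))\<^sup>2
             \<le> (INF \<theta>\<in>prob_simplex. 1 / real CARD('n) * (norm (lin_comb f \<theta> - f0))\<^sup>2)
               + 2 * tstar_sq \<sigma> CARD('n) CARD('m) (dict_radius f)
               + 4 * \<sigma>\<^sup>2 * x / real CARD('n)}
         > 1 - exp (- x)"
proof (intro allI impI)
  fix x :: real assume x: "0 < x"
  interpret prob_space P by fact
  define K where "K = lin_comb f ` prob_simplex"
  have cont: "continuous_on UNIV (lin_comb f)"
    using linear_lin_comb by (rule linear_continuous_on[OF linear_conv_bounded_linear[THEN iffD1]])
  have K: "convex K" "closed K" "K \<noteq> {}"
    unfolding K_def
    using convex_linear_image[OF linear_lin_comb convex_prob_simplex]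
      compact_imp_closed[OF compact_continuous_image[OF continuous_on_subset[OF cont] compact_prob_simplex]]
      prob_simplex_nonempty
    by auto
  have proj: "lin_comb f (\<theta>hat \<omega>) = closest_point K (f0 + \<xi> \<omega>)" if \<omega>: "\<omega> \<in> space P" for \<omega>
  proof (rule closest_point_unique[OF K(1,2)])
    note min = assms(6)[OF \<omega>, unfolded assms(5)[OF \<omega>] is_arg_min_def]
    show "lin_comb f (\<theta>hat \<omega>) \<in> K" using min by (auto simp: K_def)
    show "\<forall>z\<in>K. dist (f0 + \<xi> \<omega>) (lin_comb f (\<theta>hat \<omega>)) \<le> dist (f0 + \<xi> \<omega>) z"
      using min by (auto simp: K_def dist_norm norm_minus_commute not_less intro: power2_le_imp_le)
  qed
  define c where "c = closest_point K f0"
  have c: "c \<in> K" unfolding c_def by (rule closest_point_in_set[OF K(2,3)])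
  define I where "I = (INF \<theta>\<in>prob_simplex. 1 / real CARD('n) * (norm (lin_comb f \<theta> - f0))\<^sup>2)"
  have I: "1 / real CARD('n) * (norm (c - f0))\<^sup>2 \<le> I"
    unfolding I_def
  proof (rule cINF_greatest[OF prob_simplex_nonempty])
    fix \<theta> :: "real ^ 'm" assume "\<theta> \<in> prob_simplex"
    then have "dist f0 c \<le> dist f0 (lin_comb f \<theta>)"
      unfolding c_def by (intro closest_point_le K) (simp add: K_def)
    then show "1 / real CARD('n) * (norm (c - f0))\<^sup>2 \<le> 1 / real CARD('n) * (norm (lin_comb f \<theta> - f0))\<^sup>2"
      by (intro mult_left_mono power_mono) (auto simp: dist_norm norm_minus_commute)
  qed
  define t where "t = tstar_sq \<sigma> CARD('n) CARD('m) (dict_radius f)"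
  obtain A where A: "A \<in> sets P" "1 - exp (- x) < prob A"
    "\<And>\<omega> u. \<omega> \<in> A \<Longrightarrow> u \<in> K \<Longrightarrow>
      2 * (\<xi> \<omega> \<bullet> (u - c)) - (norm (u - c))\<^sup>2 \<le> real CARD('n) * (2 * t) + 4 * \<sigma>\<^sup>2 * x"
    using dictionary_noise_bound[OF assms(1,2,4) c[unfolded K_def] x] unfolding K_def t_def by metis
  let ?E = "{\<omega> \<in> space P. 1 / real CARD('n) * (norm (lin_comb f (\<theta>hat \<omega>) - f0))\<^sup>2
      \<le> I + 2 * t + 4 * \<sigma>\<^sup>2 * x / real CARD('n)}"
  have "A \<subseteq> ?E"
  proof
    fix \<omega> assume \<omega>: "\<omega> \<in> A"
    then have sp: "\<omega> \<in> space P" using A(1) sets.sets_into_space by blast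
    define u where "u = closest_point K (f0 + \<xi> \<omega>)"
    have "u \<in> K" unfolding u_def by (rule closest_point_in_set[OF K(2,3)])
    then have "(norm (u - f0))\<^sup>2 \<le> (norm (c - f0))\<^sup>2 + (real CARD('n) * (2 * t) + 4 * \<sigma>\<^sup>2 * x)"
      using basic_inequality[OF K(1,2) c u_def] A(3)[OF \<omega>] by fastforce
    then have "1 / real CARD('n) * (norm (u - f0))\<^sup>2
        \<le> 1 / real CARD('n) * ((norm (c - f0))\<^sup>2 + (real CARD('n) * (2 * t) + 4 * \<sigma>\<^sup>2 * x))"
      by (intro mult_left_mono) auto
    also have "\<dots> = 1 / real CARD('n) * (norm (c - f0))\<^sup>2 + 2 * t + 4 * \<sigma>\<^sup>2 * x / real CARD('n)"
      by (simp add: field_simps)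
    finally show "\<omega> \<in> ?E" using I sp proj[OF sp] by (simp add: u_def)
  qed
  \<comment> \<open>The vector defined by the weights \<open>\<theta>hat\<close> is a projection, hence a continuous
    function of the data; this is what makes the event measurable.\<close>
  moreover have "?E \<in> sets P"
  proof -
    have [measurable]: "\<xi> \<in> borel_measurable P"
      by (rule isotropic_gaussian_measurable) fact
    have [measurable]: "closest_point K \<in> borel_measurable borel"
      by (intro borel_measurable_continuous_onI continuous_on_closest_point K)
    have "?E = {\<omega> \<in> space P. 1 / real CARD('n) * (norm (closest_point K (f0 + \<xi> \<omega>) - f0))\<^sup>2
      \<le> I + 2 * t + 4 * \<sigma>\<^sup>2 * x / real CARD('n)}"
      using proj by auto
    also have "\<dots> \<in> sets P" by measurable
    finally show ?thesis .
  qed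
  ultimately have "prob A \<le> prob ?E" by (rule finite_measure_mono)
  with A(2) have "1 - exp (- x) < prob ?E" by linarith
  then show "1 - exp (- x) < measure P {\<omega> \<in> space P.
           1 / real CARD('n) * (norm (lin_comb f (\<theta>hat \<omega>) - f0))\<^sup>2
             \<le> (INF \<theta>\<in>prob_simplex. 1 / real CARD('n) * (norm (lin_comb f \<theta> - f0))\<^sup>2)
               + 2 * tstar_sq \<sigma> CARD('n) CARD('m) (dict_radius f)
               + 4 * \<sigma>\<^sup>2 * x / real CARD('n)}"
    by (simp only: I_def t_def)
qed

end
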